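(* Let $X\ge0$ be a random variable with continuous cdf $F$, and let $X_1,X_2,\dots$ be i.i.d. copies of $X$. Let $\Delta_n=\widehat D_n-\widetilde D_n$. If $\mathbb E|X|^{2+\delta}<\infty$ for some $\delta>0$, then $$\sqrt n\,|\Delta_n|\longrightarrow0\quad\text{in probability as }n\to\infty.$$
   Context: Let $F_n(x)=\frac1n\sum_{i=1}^n\mathbf 1_{[0,x]}(X_i)$, $\overline X_n=\frac1n\sum_{i=1}^n X_i$, $F_n^{-1}(s)=\inf\{x:F_n(x)\ge s\}$, $l_n(p)=\frac{1}{\overline X_n}\int_0^pF_n^{-1}(s)\,ds$, $m_n(p)=\frac{1}{\overline X_n}\int_{1-p}^1F_n^{-1}(s)\,ds$. The first estimator is $$\widehat D_n=\int_0^1\frac{m_n(p)-l_n(p)}{m_n(p)}\,dp=1-\int_0^1G_n(p)\,dp,\qquad G_n(p)=\frac{l_n(p)}{m_n(p)} .$$ With $X_{1:n}\le\cdots\le X_{n:n}$ the order statistics of $X_1,\dots,X_n$, the second estimator is $$\widetilde D_n=1-\frac1n\sum_{i=1}^n\frac{\sum_{k=1}^iX_{k:n}}{\sum_{k=n-i+1}^nX_{k:n}}=1-\frac1n\sum_{i=1}^nG_n(i/n).$$ *)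

theory Defs
  imports "HOL-Probability.Probability"
begin

text \<open>
  All sample quantities are functions of a deterministic sequence of observations
  \<open>x :: nat \<Rightarrow> real\<close> and the sample size \<open>n\<close>; the sample consists of \<open>x 1, \<dots>, x n\<close>
  (the entry \<open>x 0\<close> is never used).
\<close>

definition emp_cdf :: "(nat \<Rightarrow> real) \<Rightarrow> nat \<Rightarrow> real \<Rightarrow> real" where
  "emp_cdf x n t = (1 / real n) * (\<Sum>i=1..n. indicator {0..t} (x i))"

definition sample_mean :: "(nat \<Rightarrow> real) \<Rightarrow> nat \<Rightarrow> real" where
  "sample_mean x n = (1 / real n) * (\<Sum>i=1..n. x i)"

text \<open>
  For a nonnegative sample and \<open>0 < s \<le> 1\<close> the set below is nonempty and bounded below by 0.
  At \<open>s = 0\<close> it is the whole line, so that the value is unspecified there; this single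
  point does not influence the integrals in which the quantile function is used.
\<close>

definition emp_quantile :: "(nat \<Rightarrow> real) \<Rightarrow> nat \<Rightarrow> real \<Rightarrow> real" where
  "emp_quantile x n s = Inf {t. s \<le> emp_cdf x n t}"

definition lower_share :: "(nat \<Rightarrow> real) \<Rightarrow> nat \<Rightarrow> real \<Rightarrow> real" where
  "lower_share x n p = (1 / sample_mean x n) * (LBINT s:{0..p}. emp_quantile x n s)"

definition upper_share :: "(nat \<Rightarrow> real) \<Rightarrow> nat \<Rightarrow> real \<Rightarrow> real" where
  "upper_share x n p = (1 / sample_mean x n) * (LBINT s:{1-p..1}. emp_quantile x n s)"

definition D_hat :: "(nat \<Rightarrow> real) \<Rightarrow> nat \<Rightarrow> real" where
  "D_hat x n =
     (LBINT p:{0..1}. (upper_share x n p - lower_share x n p) / upper_share x n p)"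

text \<open>The \<open>k\<close>-th smallest of \<open>x 1, \<dots>, x n\<close>, meaningful for \<open>1 \<le> k \<le> n\<close>.\<close>

definition order_stat :: "(nat \<Rightarrow> real) \<Rightarrow> nat \<Rightarrow> nat \<Rightarrow> real" where
  "order_stat x n k = sort (map x [1..<n+1]) ! (k - 1)"

definition D_tilde :: "(nat \<Rightarrow> real) \<Rightarrow> nat \<Rightarrow> real" where
  "D_tilde x n =
     1 - (1 / real n) *
       (\<Sum>i=1..n. (\<Sum>k=1..i. order_stat x n k) / (\<Sum>k=n-i+1..n. order_stat x n k))"

text \<open>
  Measurability is part of the definition: \<open>measure\<close> is 0 on non-measurable sets, so the
  limit alone could hold vacuously.
\<close>

definition converges_in_probability ::
    "'a measure \<Rightarrow> (nat \<Rightarrow> 'a \<Rightarrow> real) \<Rightarrow> ('a \<Rightarrow> real) \<Rightarrow> bool" where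
  "converges_in_probability M Y Z \<longleftrightarrow>
     (\<forall>n. Y n \<in> borel_measurable M) \<and> Z \<in> borel_measurable M \<and>
     (\<forall>\<epsilon>>0. (\<lambda>n. measure M {\<omega> \<in> space M. \<bar>Y n \<omega> - Z \<omega>\<bar> > \<epsilon>}) \<longlonglongrightarrow> 0)"

end

theory Submission
  imports Defs
begin

text \<open>
  The two estimators differ by at most \<open>1 / n\<close> on every sample of positive observations, so that
  \<open>sqrt n\<close> times their distance is at most \<open>1 / sqrt n\<close>. This is a statement about a single
  sample; probability enters only to make all observations positive.

  The bound rests on the monotonicity of \<open>G = l / m\<close>, the ratio of lower to upper share. Numerator
  and denominator both increase, but the lower share integrates an increasing quantile function
  from the left and so is convex in \<open>p\<close>, whereas the upper share integrates it from the right and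
  so is concave. Both vanish at 0. Hence \<open>l p / p\<close> increases, \<open>m p / p\<close> decreases, and their quotient
  \<open>G\<close> increases, from 0 to 1 (lemma \<open>lower_upper_ratio_mono\<close>).

  The empirical quantile function is the step function with value \<open>order_stat x n k\<close> on
  \<open>((k-1)/n, k/n]\<close>, so the quotients in \<open>D_tilde\<close> are the values \<open>G (i/n)\<close>. Thus \<open>1 - D_hat\<close> is the
  integral of \<open>G\<close> over the unit interval and \<open>1 - D_tilde\<close> is its right Riemann sum with mesh
  \<open>1 / n\<close>. For a monotone function the right sum exceeds the integral by at most the difference
  between right and left sum, which telescopes to \<open>(G 1 - G 0) / n = 1 / n\<close>
  (lemmas \<open>monotone_riemann_sum_error\<close> and \<open>D_hat_D_tilde_close\<close>).

  A continuous cdf has no atom at 0, so the nonnegative \<open>X\<close> is almost surely positive, and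
  therefore so are any finitely many of its copies. The event that \<open>sqrt n\<close> times the distance
  exceeds \<open>\<epsilon>\<close> is then null as soon as \<open>1 / sqrt n < \<epsilon>\<close>.

  Convergence in probability also requires the distance to be measurable as a function of the
  outcome, including those outcomes of probability zero where some observation is negative and
  the quantile function takes default values. This is why \<open>emp_quantile_sublevel\<close> and
  \<open>emp_quantile_le_iff\<close> describe the empirical quantile of an arbitrary real sample.
\<close>

section \<open>Monotone functions, step functions and Riemann sums\<close>

lemma set_integrable_mono_on_Ioc:
  fixes q :: "real \<Rightarrow> real"
  assumes mono: "mono_on {a<..b} q" and lower: "\<And>s. s \<in> {a<..b} \<Longrightarrow> c \<le> q s"
  shows "set_integrable lborel {a<..b} q"
proof -
  have "(\<lambda>s. indicator {a<..b} s *\<^sub>R q s) \<in> borel_measurable borel"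
    using borel_measurable_mono_on_fnc[OF mono]
    by (subst (asm) borel_measurable_restrict_space_iff) auto
  moreover have "norm (indicator {a<..b} s *\<^sub>R q s) \<le> \<bar>c\<bar> + \<bar>q b\<bar>" if "s \<in> {a<..b}" for s
    using that lower[OF that] mono_onD[OF mono, of s b] by (auto simp: indicator_def)
  ultimately show ?thesis
    unfolding set_integrable_def
    by (intro integrableI_bounded_set[where A="{a<..b}" and B="\<bar>c\<bar> + \<bar>q b\<bar>"])
      (auto intro!: AE_I2 simp: emeasure_bounded_finite[simplified])
qed

lemma LBINT_Icc_eq_Ioc:
  fixes f :: "real \<Rightarrow> real"
  assumes "a \<le> b"
  shows "(LBINT s:{a..b}. f s) = (LBINT s:{a<..b}. f s)"
  using assms interval_integral_Icc[of a b f] interval_integral_Ioc[of a b f] by simp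

lemma LBINT_Ioc_split:
  fixes f :: "real \<Rightarrow> real"
  assumes "a \<le> b" "b \<le> c" and int: "set_integrable lborel {a<..c} f"
  shows "(LBINT s:{a<..c}. f s) = (LBINT s:{a<..b}. f s) + (LBINT s:{b<..c}. f s)"
proof -
  have "{a<..c} = {a<..b} \<union> {b<..c}" using assms by auto
  moreover have "(LBINT s:{a<..b} \<union> {b<..c}. f s) = (LBINT s:{a<..b}. f s) + (LBINT s:{b<..c}. f s)"
    using assms by (intro set_integral_Un) (auto intro: set_integrable_subset[OF int])
  ultimately show ?thesis by simp
qed

lemma LBINT_Ioc_const: "a \<le> b \<Longrightarrow> (LBINT s:{a<..b}. (c::real)) = (b - a) * c"
  by (subst set_integral_const) (simp_all add: emeasure_lborel_Ioc)

lemma set_integrable_Ioc_const: "set_integrable lborel {a<..b::real} (\<lambda>_. c::real)"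
  by (rule set_integrable_mono_on_Ioc[where c=c]) (auto simp: mono_on_def)

text \<open>
  A right Riemann sum with mesh \<open>1 / n\<close> is the integral of a step function that reads its argument
  through \<open>\<lceil>n s\<rceil>\<close>. The formula serves both for the order statistics, which are the steps of
  the empirical quantile function, and for the sums that enclose the integral of \<open>G\<close>.
\<close>

lemma step_function_integral:
  fixes h :: "nat \<Rightarrow> real"
  assumes n: "n > 0"
  shows "set_integrable lborel {0<..real i / real n} (\<lambda>s. h (nat \<lceil>real n * s\<rceil>)) \<and>
    (LBINT s:{0<..real i / real n}. h (nat \<lceil>real n * s\<rceil>)) = (1 / real n) * (\<Sum>k=1..i. h k)"
proof (induction i)
  case 0
  show ?case by (simp add: set_integrable_def set_lebesgue_integral_def)
next
  case (Suc i)
  let ?q = "\<lambda>s. h (nat \<lceil>real n * s\<rceil>)"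
  let ?A = "{0<..real i / real n}" and ?B = "{real i / real n<..real (Suc i) / real n}"
  have un: "{0<..real (Suc i) / real n} = ?A \<union> ?B"
    using n by (auto simp: field_simps) (smt (verit) of_nat_0_le_iff mult_nonneg_nonneg zero_less_mult_pos2 of_nat_0_less_iff)
  have const: "?q s = h (Suc i)" if "s \<in> ?B" for s
  proof -
    have "real i < real n * s" "real n * s \<le> real (Suc i)"
      using that n by (auto simp: field_simps)
    then have "\<lceil>real n * s\<rceil> = int (Suc i)"
      by (intro ceiling_unique) auto
    then show ?thesis by (simp only: nat_int)
  qed
  have intB: "set_integrable lborel ?B ?q"
    using set_integrable_Ioc_const[of "real i / real n" "real (Suc i) / real n" "h (Suc i)"] const
    by (subst set_integrable_cong[OF refl refl, where f'="\<lambda>_. h (Suc i)"]) auto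
  have valB: "(LBINT s:?B. ?q s) = (1 / real n) * h (Suc i)"
  proof -
    have "(LBINT s:?B. ?q s) = (LBINT s:?B. h (Suc i))"
      using const by (intro set_lebesgue_integral_cong) auto
    also have "\<dots> = (1 / real n) * h (Suc i)"
      by (subst LBINT_Ioc_const) (auto simp: divide_right_mono simp flip: diff_divide_distrib)
    finally show ?thesis .
  qed
  have disj: "?A \<inter> ?B = {}" by auto
  show ?case
    unfolding un using Suc.IH intB
    by (subst set_integral_Un[OF disj])
      (simp_all add: valB distrib_left set_integrable_Un del: of_nat_Suc)
qed

text \<open>
  On a cell \<open>((k-1)/n, k/n]\<close> a monotone function lies between its values at the two end points.
  The integrals of the two resulting step functions are the left and the right sum.
\<close>

lemma monotone_riemann_sum_error:
  fixes g :: "real \<Rightarrow> real"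
  assumes n: "n > 0" and mono: "mono_on {0..1} g"
  shows "\<bar>(LBINT p:{0<..1}. g p) - (1 / real n) * (\<Sum>i=1..n. g (real i / real n))\<bar>
           \<le> (g 1 - g 0) / real n"
proof -
  let ?up = "\<lambda>s. g (real (nat \<lceil>real n * s\<rceil>) / real n)"
  let ?lo = "\<lambda>s. g (real (nat \<lceil>real n * s\<rceil> - 1) / real n)"
  have up: "set_integrable lborel {0<..1} ?up"
      "(LBINT s:{0<..1}. ?up s) = (1 / real n) * (\<Sum>i=1..n. g (real i / real n))"
    using step_function_integral[OF n, where i=n and h="\<lambda>k. g (real k / real n)"] n by auto
  have lo: "set_integrable lborel {0<..1} ?lo"
      "(LBINT s:{0<..1}. ?lo s) = (1 / real n) * (\<Sum>i=1..n. g (real (i - 1) / real n))"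
    using step_function_integral[OF n, where i=n and h="\<lambda>k. g (real (k - 1) / real n)"] n by auto
  have int: "set_integrable lborel {0<..1} g"
    by (rule set_integrable_mono_on_Ioc[where c="g 0"])
      (auto intro: mono_on_subset[OF mono] mono_onD[OF mono])
  have sandwich: "?lo s \<le> g s \<and> g s \<le> ?up s" if "s \<in> {0<..1}" for s
  proof -
    define k where "k = nat \<lceil>real n * s\<rceil>"
    have ns: "0 < real n * s" "real n * s \<le> real n"
      using that n by auto
    have k: "1 \<le> k" "k \<le> n" "real n * s \<le> real k" "real k - 1 \<le> real n * s"
      using ns unfolding k_def by linarith+
    have "real (k - 1) / real n \<le> s" "s \<le> real k / real n"
      using k n by (auto simp: field_simps of_nat_diff)
    then show ?thesis
      using that k n unfolding k_def[symmetric]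
      by (auto intro!: mono_onD[OF mono] simp: field_simps)
  qed
  have "(\<Sum>i=1..n. g (real i / real n)) - (\<Sum>i=1..n. g (real (i - 1) / real n))
      = (\<Sum>i=1..n. g (real i / real n) - g (real (i - 1) / real n))"
    by (simp add: sum_subtractf)
  also have "\<dots> = g 1 - g 0"
    using n sum_telescope''[of 0 n "\<lambda>i. g (real i / real n)"]
    by (simp add: atLeastSucAtMost_greaterThanAtMost[symmetric])
  finally have "(LBINT s:{0<..1}. ?up s) - (LBINT s:{0<..1}. ?lo s) = (g 1 - g 0) / real n"
    unfolding up(2) lo(2) by (simp only: right_diff_distrib[symmetric]) simp
  moreover have "(LBINT s:{0<..1}. ?lo s) \<le> (LBINT s:{0<..1}. g s)"
      "(LBINT s:{0<..1}. g s) \<le> (LBINT s:{0<..1}. ?up s)"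
    using sandwich by (intro set_integral_mono lo up int; blast)+
  ultimately show ?thesis unfolding up by linarith
qed

section \<open>The ratio of lower to upper shares is monotone\<close>

text \<open>
  Convexity of \<open>L\<close> and concavity of \<open>U\<close> enter as the monotonicity of \<open>L p / p\<close> and \<open>U p / p\<close>, which
  follows from comparing averages. For \<open>r < p\<close>, the mean of \<open>q\<close> over \<open>(0, r]\<close> is at most \<open>q r\<close> and its mean over
  \<open>(r, p]\<close> is at least \<open>q r\<close>, which gives \<open>p * L r \<le> r * L p\<close>. At the other end of the unit interval,
  the comparison with \<open>q (1 - r)\<close> gives \<open>r * U p \<le> p * U r\<close>. Multiplying the two yields the
  claim. At \<open>p = 0\<close> the ratio is \<open>0 / 0 = 0\<close>, which lies below all
  other values, as these are nonnegative.
\<close>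

lemma lower_upper_ratio_mono:
  fixes q :: "real \<Rightarrow> real"
  defines "L \<equiv> \<lambda>p. LBINT s:{0<..p}. q s"
    and "U \<equiv> \<lambda>p. LBINT s:{1-p<..1}. q s"
  assumes mono: "mono_on {0<..1} q" and pos: "\<And>s. s \<in> {0<..1} \<Longrightarrow> 0 < q s"
  shows "mono_on {0..1} (\<lambda>p. L p / U p)"
    and "\<And>p. 0 < p \<Longrightarrow> p \<le> 1 \<Longrightarrow> 0 < U p"
proof -
  have int: "set_integrable lborel {0<..1} q"
    using mono pos by (intro set_integrable_mono_on_Ioc[where c=0]) (auto simp: less_imp_le)
  have sub: "set_integrable lborel {a<..b} q" if "0 \<le> a" "b \<le> 1" for a b
    using that by (intro set_integrable_subset[OF int]) auto
  have above: "(b - a) * c \<le> (LBINT s:{a<..b}. q s)"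
    if "0 \<le> a" "a \<le> b" "b \<le> 1" "\<And>s. a < s \<Longrightarrow> s \<le> b \<Longrightarrow> c \<le> q s" for a b c
    unfolding LBINT_Ioc_const[OF that(2), symmetric]
    using that by (intro set_integral_mono set_integrable_Ioc_const sub) auto
  have below: "(LBINT s:{a<..b}. q s) \<le> (b - a) * c"
    if "0 \<le> a" "a \<le> b" "b \<le> 1" "\<And>s. a < s \<Longrightarrow> s \<le> b \<Longrightarrow> q s \<le> c" for a b c
    unfolding LBINT_Ioc_const[OF that(2), symmetric]
    using that by (intro set_integral_mono set_integrable_Ioc_const sub) auto
  have L0: "L 0 = 0" by (simp add: L_def set_lebesgue_integral_def)
  have L_nonneg: "0 \<le> L p" if "0 \<le> p" "p \<le> 1" for p
    using above[of 0 p 0] that pos by (force simp: L_def less_imp_le)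
  have U_nonneg: "0 \<le> U p" if "0 \<le> p" "p \<le> 1" for p
    using above[of "1 - p" 1 0] that pos by (force simp: U_def less_imp_le)
  \<comment> \<open>When \<open>p = 1\<close>, \<open>q\<close> may tend to 0 at the left end point \<open>1 - p\<close>, so the positive lower bound
    for \<open>U p\<close> comes from the right half of its interval, where \<open>q\<close> is at least \<open>q (1 - p/2)\<close>.\<close>
  show U_pos: "0 < U p" if p: "0 < p" "p \<le> 1" for p
  proof -
    have "(1 - (1 - p/2)) * q (1 - p/2) \<le> (LBINT s:{1-p/2<..1}. q s)"
      using p by (intro above) (auto intro!: mono_onD[OF mono])
    moreover have "0 \<le> (LBINT s:{1-p<..1-p/2}. q s)"
      using above[of "1 - p" "1 - p/2" 0] p pos by (force simp: less_imp_le)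
    moreover have "U p = (LBINT s:{1-p<..1-p/2}. q s) + (LBINT s:{1-p/2<..1}. q s)"
      unfolding U_def using p by (intro LBINT_Ioc_split sub) auto
    moreover have "0 < (1 - (1 - p/2)) * q (1 - p/2)"
      using p pos[of "1 - p/2"] by simp
    ultimately show ?thesis by linarith
  qed
  show "mono_on {0..1} (\<lambda>p. L p / U p)"
  proof (rule mono_onI)
    fix r p :: real
    assume rp: "r \<in> {0..1}" "p \<in> {0..1}" "r \<le> p"
    show "L r / U r \<le> L p / U p"
    proof (cases "r = 0 \<or> r = p")
      case True
      then show ?thesis
        using L0 L_nonneg U_nonneg rp by auto
    next
      case False
      then have r: "0 < r" "r < p" "p \<le> 1" using rp by auto
      have Lsplit: "L p = L r + (LBINT s:{r<..p}. q s)"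
        unfolding L_def using r by (intro LBINT_Ioc_split sub) auto
      have Usplit: "U p = (LBINT s:{1-p<..1-r}. q s) + U r"
        unfolding U_def using r by (intro LBINT_Ioc_split sub) auto
      have "L r \<le> (r - 0) * q r"
        unfolding L_def using r by (intro below) (auto intro!: mono_onD[OF mono])
      then have L1: "L r * (p - r) \<le> r * q r * (p - r)"
        using r by (intro mult_right_mono) auto
      have "(p - r) * q r \<le> (LBINT s:{r<..p}. q s)"
        using r by (intro above) (auto intro!: mono_onD[OF mono])
      then have "r * ((p - r) * q r) \<le> r * (L p - L r)"
        using r Lsplit by (intro mult_left_mono) auto
      with L1 have Lcvx: "L r * p \<le> r * L p"
        by (simp add: algebra_simps)
      have "(1 - (1 - r)) * q (1 - r) \<le> U r"
        unfolding U_def using r by (intro above) (auto intro!: mono_onD[OF mono])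
      then have U1: "r * q (1 - r) * (p - r) \<le> U r * (p - r)"
        using r by (intro mult_right_mono) auto
      have "(LBINT s:{1-p<..1-r}. q s) \<le> ((1 - r) - (1 - p)) * q (1 - r)"
        using r by (intro below) (auto intro!: mono_onD[OF mono])
      then have "r * (U p - U r) \<le> r * ((p - r) * q (1 - r))"
        using r Usplit by (intro mult_left_mono) auto
      with U1 have Uccv: "r * U p \<le> U r * p"
        by (simp add: algebra_simps)
      have "(L r * p) * (r * U p) \<le> (r * L p) * (U r * p)"
        using r L_nonneg[of p] U_nonneg[of p] by (intro mult_mono[OF Lcvx Uccv]) auto
      then have "(r * p) * (L r * U p) \<le> (r * p) * (L p * U r)"
        by (simp add: algebra_simps)
      then have "L r * U p \<le> L p * U r"
        using r by (subst (asm) mult_le_cancel_left_pos) auto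
      then show ?thesis
        using U_pos[of r] U_pos[of p] r by (simp add: field_simps)
    qed
  qed
qed

section \<open>Order statistics and empirical quantiles\<close>

lemma sorted_nth_le_iff:
  fixes t :: "'a :: linorder"
  assumes "sorted ys" "j < length ys"
  shows "ys ! j \<le> t \<longleftrightarrow> j < length (filter (\<lambda>y. y \<le> t) ys)"
  using assms
proof (induction ys arbitrary: j)
  case (Cons y ys)
  show ?case
  proof (cases "y \<le> t")
    case True
    then show ?thesis using Cons by (cases j) auto
  next
    case False
    then have "filter (\<lambda>y. y \<le> t) ys = []"
      using Cons.prems(1) by (auto simp: filter_empty_conv)
    moreover have "\<not> (y # ys) ! j \<le> t"
      using False Cons.prems by (cases j) (auto dest!: nth_mem)
    ultimately show ?thesis using False by auto
  qed
qed simp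

lemma sort_nth_le_iff:
  fixes t :: "'a :: linorder"
  assumes "j < length ys"
  shows "sort ys ! j \<le> t \<longleftrightarrow> j < length (filter (\<lambda>y. y \<le> t) ys)"
  using sorted_nth_le_iff[of "sort ys" j t] assms by (simp add: filter_sort)

lemma length_filter_sample:
  "real (length (filter (\<lambda>y. y \<in> A) (map x [1..<n+1]))) = (\<Sum>i=1..n. indicator A (x i))"
  by (induction n) (auto simp: indicator_def)

text \<open>
  Counting the observations up to a level describes order statistics without reference to
  sorting, and makes them visibly measurable functions of the sample.
\<close>

lemma order_stat_le_iff:
  assumes "1 \<le> k" "k \<le> n"
  shows "order_stat x n k \<le> t \<longleftrightarrow> real k \<le> (\<Sum>i=1..n. indicator {..t} (x i))"
proof -
  have "order_stat x n k \<le> t \<longleftrightarrow> k - 1 < length (filter (\<lambda>y. y \<in> {..t}) (map x [1..<n+1]))"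
    unfolding order_stat_def using assms by (subst sort_nth_le_iff) auto
  also have "\<dots> \<longleftrightarrow> real k \<le> real (length (filter (\<lambda>y. y \<in> {..t}) (map x [1..<n+1])))"
    using assms by auto
  finally show ?thesis by (simp only: length_filter_sample)
qed

lemma order_stat_mem:
  assumes "1 \<le> k" "k \<le> n"
  shows "order_stat x n k \<in> x ` {1..n}"
proof -
  have "sort (map x [1..<n+1]) ! (k - 1) \<in> set (sort (map x [1..<n+1]))"
    using assms by (intro nth_mem) auto
  then show ?thesis
    unfolding order_stat_def by (auto simp: image_iff)
qed

lemma order_stat_mono: "k \<le> l \<Longrightarrow> l \<le> n \<Longrightarrow> 1 \<le> k \<Longrightarrow> order_stat x n k \<le> order_stat x n l"
  unfolding order_stat_def by (intro sorted_nth_mono) auto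

text \<open>
  The empirical cdf counts only nonnegative observations, so for samples with negative entries the
  quantile is an order statistic of the nonnegative part \<open>ys\<close> of the sample. The level \<open>s\<close> must not
  exceed the proportion of nonnegative observations, beyond which the set is empty. The set
  contains its left end point, so the infimum that defines the quantile is attained.
\<close>

lemma emp_quantile_sublevel:
  assumes s: "0 < s" "s \<le> (1 / real n) * (\<Sum>i=1..n. indicator {0..} (x i))"
  defines "ys \<equiv> filter (\<lambda>y. y \<in> {0..}) (map x [1..<n+1])"
  shows "{t. s \<le> emp_cdf x n t} = {sort ys ! (nat \<lceil>real n * s\<rceil> - 1)..}"
proof -
  have n: "n > 0" using s by (cases n) auto
  define k where "k = nat \<lceil>real n * s\<rceil>"
  have k: "1 \<le> k" "\<And>m::nat. real n * s \<le> real m \<longleftrightarrow> k \<le> m"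
    using n s unfolding k_def by (auto simp: nat_le_iff ceiling_le_iff Suc_le_eq)
  have len: "k \<le> length ys"
    using s n unfolding k(2)[symmetric] ys_def length_filter_sample by (simp add: field_simps)
  have "s \<le> emp_cdf x n t \<longleftrightarrow> sort ys ! (k - 1) \<le> t" for t
  proof -
    have "filter (\<lambda>y. y \<in> {0..t}) (map x [1..<n+1]) = filter (\<lambda>y. y \<le> t) ys"
      unfolding ys_def filter_filter by (rule filter_cong) auto
    then have "emp_cdf x n t = real (length (filter (\<lambda>y. y \<le> t) ys)) / real n"
      unfolding emp_cdf_def length_filter_sample[symmetric] by simp
    then have "s \<le> emp_cdf x n t \<longleftrightarrow> real n * s \<le> real (length (filter (\<lambda>y. y \<le> t) ys))"
      using n by (simp add: pos_le_divide_eq mult.commute)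
    also have "\<dots> \<longleftrightarrow> sort ys ! (k - 1) \<le> t"
      unfolding k(2) using k(1) len by (subst sort_nth_le_iff) auto
    finally show ?thesis .
  qed
  then show ?thesis unfolding k_def by auto
qed

lemma emp_quantile_eq_order_stat:
  assumes n: "n > 0" and nonneg: "\<And>i. i \<in> {1..n} \<Longrightarrow> 0 \<le> x i" and s: "0 < s" "s \<le> 1"
  shows "emp_quantile x n s = order_stat x n (nat \<lceil>real n * s\<rceil>)"
proof -
  have "(\<Sum>i=1..n. indicator {0..} (x i)) = (\<Sum>i=1..n. 1::real)"
    using nonneg by (intro sum.cong) auto
  then have "s \<le> (1 / real n) * (\<Sum>i=1..n. indicator {0..} (x i))"
    using n s by simp
  moreover have "filter (\<lambda>y. y \<in> {0..}) (map x [1..<n+1]) = map x [1..<n+1]"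
    using nonneg by (auto simp: filter_id_conv)
  ultimately show ?thesis
    using emp_quantile_sublevel[of s n x] s unfolding emp_quantile_def order_stat_def by simp
qed

lemma emp_cdf_bounds:
  "0 \<le> emp_cdf x n t" "emp_cdf x n t \<le> (1 / real n) * (\<Sum>i=1..n. indicator {0..} (x i))"
proof -
  show "0 \<le> emp_cdf x n t"
    unfolding emp_cdf_def by (simp add: sum_nonneg)
  have "(\<Sum>i=1..n. indicator {0..t} (x i)) \<le> (\<Sum>i=1..n. indicator {0..} (x i) :: real)"
    by (rule sum_mono) (simp add: indicator_def)
  then show "emp_cdf x n t \<le> (1 / real n) * (\<Sum>i=1..n. indicator {0..} (x i))"
    unfolding emp_cdf_def by (intro mult_left_mono) simp_all
qed

text \<open>
  For \<open>s \<le> 0\<close> the infimum is taken over the whole line and for large \<open>s\<close> over the empty set. Both are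
  unspecified but fixed real numbers, so every sublevel set is given by inequalities between
  measurable functions of the sample and the level.
\<close>

lemma emp_quantile_le_iff:
  "emp_quantile x n s \<le> t \<longleftrightarrow>
     (if s \<le> 0 then Inf UNIV \<le> t
      else if (1 / real n) * (\<Sum>i=1..n. indicator {0..} (x i)) < s then Inf {} \<le> t
      else s \<le> emp_cdf x n t)"
proof -
  let ?N = "(1 / real n) * (\<Sum>i=1..n. indicator {0..} (x i))"
  consider "s \<le> 0" | "0 < s" "?N < s" | "0 < s" "s \<le> ?N" by linarith
  then show ?thesis
  proof cases
    case 1
    then have "{t. s \<le> emp_cdf x n t} = UNIV"
      using emp_cdf_bounds(1)[of x n] by (auto intro: order_trans)
    then show ?thesis using 1 unfolding emp_quantile_def by simp
  next
    case 2
    then have "{t. s \<le> emp_cdf x n t} = {}"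
      using emp_cdf_bounds(2)[of x n] by (force simp: not_le intro: le_less_trans)
    then show ?thesis using 2 unfolding emp_quantile_def by simp
  next
    case 3
    note sub = emp_quantile_sublevel[OF 3]
    have "emp_quantile x n s \<le> t \<longleftrightarrow> t \<in> {t. s \<le> emp_cdf x n t}"
      unfolding emp_quantile_def sub by simp
    then show ?thesis using 3 by simp
  qed
qed

section \<open>The two estimators on a positive sample\<close>

text \<open>
  Positivity of the sample makes \<open>U p\<close> positive for all \<open>p > 0\<close>, so that the integrand of \<open>D_hat\<close>
  is \<open>1 - G p\<close>, and makes \<open>G 1 = 1\<close>. For the zero sample the two estimators would be 0 and 1.
\<close>

lemma D_hat_D_tilde_close:
  assumes n: "n > 0" and pos: "\<And>i. i \<in> {1..n} \<Longrightarrow> 0 < x i"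
  shows "\<bar>D_hat x n - D_tilde x n\<bar> \<le> 1 / real n"
proof -
  define q where "q = (\<lambda>s. order_stat x n (nat \<lceil>real n * s\<rceil>))"
  define L where "L = (\<lambda>p. LBINT s:{0<..p}. q s)"
  define U where "U = (\<lambda>p. LBINT s:{1-p<..1}. q s)"
  define G where "G = (\<lambda>p. L p / U p)"
  have index: "1 \<le> nat \<lceil>real n * s\<rceil> \<and> nat \<lceil>real n * s\<rceil> \<le> n" if "s \<in> {0<..1}" for s
  proof -
    have "0 < real n * s" "real n * s \<le> real n" using that n by auto
    then show ?thesis by linarith
  qed
  have q_mono: "mono_on {0<..1} q"
    unfolding q_def using index
    by (intro mono_onI order_stat_mono nat_mono ceiling_mono mult_left_mono) auto
  have q_pos: "0 < q s" if "s \<in> {0<..1}" for s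
  proof -
    have "q s \<in> x ` {1..n}"
      unfolding q_def using index[OF that] by (intro order_stat_mem) simp_all
    then obtain i where "i \<in> {1..n}" "q s = x i" by (rule imageE)
    then show ?thesis using pos[of i] by simp
  qed
  have q_eq: "emp_quantile x n s = q s" if "s \<in> {0<..1}" for s
    unfolding q_def using that
    by (intro emp_quantile_eq_order_stat n less_imp_le[OF pos]) simp_all
  have G_mono: "mono_on {0..1} G" and U_pos: "\<And>p. 0 < p \<Longrightarrow> p \<le> 1 \<Longrightarrow> 0 < U p"
    using lower_upper_ratio_mono[OF q_mono q_pos] unfolding G_def L_def U_def by auto
  \<comment> \<open>The sample mean cancels in \<open>G\<close>, but only when it is not 0.\<close>
  have "0 < (\<Sum>i=1..n. x i)"
    using n by (intro sum_pos pos) simp_all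
  then have mean: "sample_mean x n \<noteq> 0"
    unfolding sample_mean_def using n by simp
  have lower: "lower_share x n p = L p / sample_mean x n" if "p \<in> {0<..1}" for p
  proof -
    have "(LBINT s:{0..p}. emp_quantile x n s) = L p"
      unfolding L_def using that
      by (subst LBINT_Icc_eq_Ioc) (auto intro!: set_lebesgue_integral_cong q_eq)
    then show ?thesis unfolding lower_share_def by simp
  qed
  have upper: "upper_share x n p = U p / sample_mean x n" if "p \<in> {0<..1}" for p
  proof -
    have "(LBINT s:{1-p..1}. emp_quantile x n s) = U p"
      unfolding U_def using that
      by (subst LBINT_Icc_eq_Ioc) (auto intro!: set_lebesgue_integral_cong q_eq)
    then show ?thesis unfolding upper_share_def by simp
  qed
  have G_int: "set_integrable lborel {0<..1} G"
    by (rule set_integrable_mono_on_Ioc[where c="G 0"])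
      (auto intro: mono_on_subset[OF G_mono] mono_onD[OF G_mono])
  have "D_hat x n = (LBINT p:{0<..1}. 1 - G p)"
    unfolding D_hat_def
  proof (subst LBINT_Icc_eq_Ioc, simp, intro set_lebesgue_integral_cong allI impI)
    fix p :: real assume p: "p \<in> {0<..1}"
    show "(upper_share x n p - lower_share x n p) / upper_share x n p = 1 - G p"
      using U_pos[of p] p mean by (simp add: lower upper G_def field_simps)
  qed simp
  also have "\<dots> = 1 - (LBINT p:{0<..1}. G p)"
    by (subst set_integral_diff(2)) (auto simp: G_int set_integrable_Ioc_const LBINT_Ioc_const)
  finally have hat: "D_hat x n = 1 - (LBINT p:{0<..1}. G p)" .
  have q_int: "set_integrable lborel {0<..1} q"
    using step_function_integral[OF n, where i=n and h="order_stat x n"] n unfolding q_def by auto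
  have L_grid: "L (real i / real n) = (1 / real n) * (\<Sum>k=1..i. order_stat x n k)" for i
    using step_function_integral[OF n, where i=i and h="order_stat x n"]
    unfolding L_def q_def by blast
  have U_grid: "U (real i / real n) = (1 / real n) * (\<Sum>k=n-i+1..n. order_stat x n k)"
    if "i \<le> n" for i
  proof -
    have eq: "1 - real i / real n = real (n - i) / real n"
      using n that by (simp add: field_simps of_nat_diff)
    have "L 1 = L (1 - real i / real n) + U (real i / real n)"
      unfolding L_def U_def using n that by (intro LBINT_Ioc_split q_int) (auto simp: field_simps)
    then have "U (real i / real n) = L (real n / real n) - L (real (n - i) / real n)"
      using n eq by simp
    also have "\<dots> = (1 / real n) *
        ((\<Sum>k=1..n. order_stat x n k) - (\<Sum>k=1..n-i. order_stat x n k))"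
      unfolding L_grid by (simp add: algebra_simps)
    also have "(\<Sum>k=1..n. order_stat x n k) =
        (\<Sum>k=1..n-i. order_stat x n k) + (\<Sum>k=n-i+1..n. order_stat x n k)"
      using sum.ub_add_nat[of 1 "n - i" "order_stat x n" i] that by simp
    finally show ?thesis by simp
  qed
  have tilde: "D_tilde x n = 1 - (1 / real n) * (\<Sum>i=1..n. G (real i / real n))"
  proof -
    have "(\<Sum>i=1..n. G (real i / real n)) =
        (\<Sum>i=1..n. (\<Sum>k=1..i. order_stat x n k) / (\<Sum>k=n-i+1..n. order_stat x n k))"
      using n by (intro sum.cong) (auto simp: G_def L_grid U_grid)
    then show ?thesis unfolding D_tilde_def by simp
  qed
  have "G 0 = 0" by (simp add: G_def L_def set_lebesgue_integral_def)
  moreover have "G 1 = 1" using U_pos[of 1] by (simp add: G_def L_def U_def)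
  ultimately show ?thesis
    using monotone_riemann_sum_error[OF n G_mono] unfolding hat tilde by auto
qed

section \<open>Measurability of the estimators\<close>

lemma borel_measurable_emp_quantile:
  assumes [measurable]: "\<And>i. i \<in> {1..n} \<Longrightarrow> Y i \<in> borel_measurable M"
    and [measurable]: "s \<in> borel_measurable M"
  shows "(\<lambda>\<omega>. emp_quantile (\<lambda>i. Y i \<omega>) n (s \<omega>)) \<in> borel_measurable M"
  unfolding borel_measurable_iff_le emp_quantile_le_iff emp_cdf_def
  by measurable

text \<open>
  The quantile is jointly measurable in outcome and level, so Fubini's theorem makes the integral
  measurable in the outcome. The end points may depend on the outcome as well; the shares need
  this when \<open>p\<close> is itself a variable of integration in \<open>D_hat\<close>.
\<close>

lemma borel_measurable_LBINT_emp_quantile: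
  assumes Y[measurable]: "\<And>i. i \<in> {1..n} \<Longrightarrow> Y i \<in> borel_measurable M"
    and [measurable]: "a \<in> borel_measurable M" "b \<in> borel_measurable M"
  shows "(\<lambda>\<omega>. LBINT s:{a \<omega>..b \<omega>}. emp_quantile (\<lambda>i. Y i \<omega>) n s) \<in> borel_measurable M"
proof -
  have [measurable]: "(\<lambda>z. emp_quantile (\<lambda>i. Y i (fst z)) n (snd z)) \<in>
      borel_measurable (M \<Otimes>\<^sub>M lborel)"
    by (rule borel_measurable_emp_quantile) measurable
  show ?thesis
    unfolding set_lebesgue_integral_def
    by (rule lborel.borel_measurable_lebesgue_integral) (simp add: split_beta' indicator_def)
qed

lemma borel_measurable_D_hat:
  assumes Y[measurable]: "\<And>i. i \<in> {1..n} \<Longrightarrow> Y i \<in> borel_measurable M"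
  shows "(\<lambda>\<omega>. D_hat (\<lambda>i. Y i \<omega>) n) \<in> borel_measurable M"
proof -
  let ?N = "M \<Otimes>\<^sub>M lborel"
  have mean: "(\<lambda>z. sample_mean (\<lambda>i. Y i (fst z)) n) \<in> borel_measurable ?N"
    unfolding sample_mean_def by measurable
  have [measurable]: "(\<lambda>z. lower_share (\<lambda>i. Y i (fst z)) n (snd z)) \<in> borel_measurable ?N"
    unfolding lower_share_def using mean
    by (intro borel_measurable_times borel_measurable_divide borel_measurable_LBINT_emp_quantile) auto
  have [measurable]: "(\<lambda>z. upper_share (\<lambda>i. Y i (fst z)) n (snd z)) \<in> borel_measurable ?N"
    unfolding upper_share_def using mean
    by (intro borel_measurable_times borel_measurable_divide borel_measurable_LBINT_emp_quantile) auto
  show ?thesis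
    unfolding D_hat_def set_lebesgue_integral_def
    by (rule lborel.borel_measurable_lebesgue_integral) (simp add: split_beta')
qed

lemma borel_measurable_D_tilde:
  assumes Y[measurable]: "\<And>i. i \<in> {1..n} \<Longrightarrow> Y i \<in> borel_measurable M"
  shows "(\<lambda>\<omega>. D_tilde (\<lambda>i. Y i \<omega>) n) \<in> borel_measurable M"
proof -
  have order: "(\<lambda>\<omega>. order_stat (\<lambda>i. Y i \<omega>) n k) \<in> borel_measurable M" if "1 \<le> k" "k \<le> n" for k
    unfolding borel_measurable_iff_le order_stat_le_iff[OF that] by measurable
  show ?thesis
    unfolding D_tilde_def
    by (intro borel_measurable_diff borel_measurable_times borel_measurable_const
        borel_measurable_sum borel_measurable_divide order) auto
qed

section \<open>Convergence in probability\<close>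

lemma AE_positive_if_continuous_cdf:
  assumes "prob_space M" and [measurable]: "X \<in> borel_measurable M"
    and nonneg: "AE \<omega> in M. 0 \<le> X \<omega>"
    and cont: "continuous_on UNIV (cdf (distr M borel X))"
  shows "AE x in distr M borel X. (0::real) < x"
proof -
  interpret prob_space M by fact
  interpret D: real_distribution "distr M borel X" by (rule real_distribution_distr) simp
  have "isCont (cdf (distr M borel X)) 0"
    using cont by (simp add: continuous_on_eq_continuous_at)
  then have "measure (distr M borel X) {0} = 0"
    by (simp add: D.isCont_cdf)
  then have "AE x in distr M borel X. x \<noteq> 0"
    by (intro AE_I[where N="{0}"]) (auto simp: D.emeasure_eq_measure)
  moreover have "AE x in distr M borel X. 0 \<le> x"
    using nonneg by (subst AE_distr_iff) auto
  ultimately show ?thesis by eventually_elim auto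
qed

theorem theorem3p5:
  fixes M :: "'a measure" and X :: "'a \<Rightarrow> real" and Xs :: "nat \<Rightarrow> 'a \<Rightarrow> real"
    and \<delta> :: real
  assumes "prob_space M"
    and "X \<in> borel_measurable M"
    and "AE \<omega> in M. 0 \<le> X \<omega>"
    and "continuous_on UNIV (cdf (distr M borel X))"
    and "prob_space.indep_vars M (\<lambda>_. borel) Xs {1..}"
    and "\<And>i. 1 \<le> i \<Longrightarrow> distr M borel (Xs i) = distr M borel X"
    and "0 < \<delta>"
    and "integrable M (\<lambda>\<omega>. \<bar>X \<omega>\<bar> powr (2 + \<delta>))"
  shows "converges_in_probability M
           (\<lambda>n \<omega>. sqrt (real n) * \<bar>D_hat (\<lambda>i. Xs i \<omega>) n - D_tilde (\<lambda>i. Xs i \<omega>) n\<bar>)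
           (\<lambda>_. 0)"
proof -
  interpret prob_space M by fact
  define Y where "Y = (\<lambda>n \<omega>. sqrt (real n) * \<bar>D_hat (\<lambda>i. Xs i \<omega>) n - D_tilde (\<lambda>i. Xs i \<omega>) n\<bar>)"
  have Xs_meas: "Xs i \<in> borel_measurable M" if "1 \<le> i" for i
    using assms(5) that unfolding indep_vars_def by auto
  have Y_meas: "Y n \<in> borel_measurable M" for n
    unfolding Y_def using Xs_meas
    by (intro borel_measurable_times borel_measurable_const borel_measurable_abs
        borel_measurable_diff borel_measurable_D_hat borel_measurable_D_tilde) auto
  have "AE \<omega> in M. 0 < Xs i \<omega>" if "1 \<le> i" for i
    using AE_positive_if_continuous_cdf[OF assms(1-4)] Xs_meas[OF that]
    unfolding assms(6)[OF that, symmetric] by (subst (asm) AE_distr_iff) auto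
  then have pos: "AE \<omega> in M. \<forall>i\<in>{1..n}. 0 < Xs i \<omega>" for n
    by (intro AE_finite_allI) auto
  have small: "AE \<omega> in M. \<bar>Y n \<omega>\<bar> \<le> 1 / sqrt (real n)" if n: "n > 0" for n
    using pos[of n]
  proof eventually_elim
    case (elim \<omega>)
    have "\<bar>D_hat (\<lambda>i. Xs i \<omega>) n - D_tilde (\<lambda>i. Xs i \<omega>) n\<bar> \<le> 1 / real n"
      using elim by (intro D_hat_D_tilde_close n) auto
    then have "\<bar>Y n \<omega>\<bar> \<le> sqrt (real n) * (1 / real n)"
      unfolding Y_def abs_mult by (intro mult_mono) auto
    also have "\<dots> = 1 / sqrt (real n)"
      using n by (simp add: field_simps)
    finally show ?case .
  qed
  have "(\<lambda>n. prob {\<omega> \<in> space M. \<bar>Y n \<omega> - 0\<bar> > \<epsilon>}) \<longlonglongrightarrow> 0" if "\<epsilon> > 0" for \<epsilon>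
  proof -
    have "(\<lambda>n. 1 / sqrt (real n)) \<longlonglongrightarrow> 0"
      by real_asymp
    then have "eventually (\<lambda>n. 1 / sqrt (real n) < \<epsilon>) sequentially"
      using \<open>\<epsilon> > 0\<close> by (rule order_tendstoD)
    then have "eventually (\<lambda>n. prob {\<omega> \<in> space M. \<bar>Y n \<omega> - 0\<bar> > \<epsilon>} = 0) sequentially"
      using eventually_gt_at_top[of 0]
    proof eventually_elim
      case (elim n)
      have "AE \<omega> in M. \<omega> \<notin> {\<omega> \<in> space M. \<bar>Y n \<omega> - 0\<bar> > \<epsilon>}"
        using small[OF elim(2)] elim(1) by (auto elim!: eventually_mono)
      then show ?case
        using Y_meas[of n] by (subst prob_eq_0) auto
    qed
    then show ?thesis by (rule tendsto_eventually)
  qed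
  then show ?thesis
    using Y_meas unfolding converges_in_probability_def Y_def by auto
qed

end
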